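(* Let $(I,\mathscr{I},\nu)$ be a probability space and $\{T_i\}_{i\in I}$ a family of maximal monotone operators on $\mathbb{R}^k$, let $\lambda>0$ and $\alpha\in(0,2)$, and assume $(i,x)\mapsto J_{\lambda T_i}(x)$ is measurable, where $J_{\lambda T}=(\mathrm{Id}+\lambda T)^{-1}$ denotes the resolvent. Let $$Z=\{x^\ast\in\mathbb{R}^k\colon 0\in T_i(x^\ast)\text{ for } \nu\text{-almost every } i\}$$ and assume $Z\neq\emptyset$. Let $(\xi_n)$ be an ergodic stationary sequence of $I$-valued random variables with distribution $\nu$, and for any $x_0\in\mathbb{R}^k$ define $X_0=x_0$, $X_{n+1}=X_n+\alpha\,(J_{\lambda T_{\xi_n}}(X_n)-X_n)$. Then $(X_n)$ converges almost surely to a random variable $X$ with $X\in Z$ almost surely.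
   Context: An operator $T\colon\mathbb{R}^k\to\mathcal{P}(\mathbb{R}^k)$ is monotone if $\langle x'-x,v'-v\rangle\ge 0$ whenever $v\in T(x)$, $v'\in T(x')$; it is maximal monotone if its graph is not properly contained in the graph of another monotone operator. For maximal monotone $T$ and $\lambda>0$, the resolvent $J_{\lambda T}=(\mathrm{Id}+\lambda T)^{-1}$ is single-valued and defined on all of $\mathbb{R}^k$. A sequence $(\xi_n)$ is ergodic stationary if its law on $I^{\mathbb{N}}$ is invariant and ergodic under the left shift. *)

theory Defs
  imports "HOL-Probability.Probability"
begin

definition monotone_op :: "('a::euclidean_space \<Rightarrow> 'a set) \<Rightarrow> bool" where
  "monotone_op T \<longleftrightarrow>
     (\<forall>x x' v v'. v \<in> T x \<longrightarrow> v' \<in> T x' \<longrightarrow> inner (x' - x) (v' - v) \<ge> 0)"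

definition maximal_monotone :: "('a::euclidean_space \<Rightarrow> 'a set) \<Rightarrow> bool" where
  "maximal_monotone T \<longleftrightarrow>
     monotone_op T \<and> (\<forall>S. monotone_op S \<and> (\<forall>x. T x \<subseteq> S x) \<longrightarrow> S = T)"

definition resolvent :: "real \<Rightarrow> ('a::euclidean_space \<Rightarrow> 'a set) \<Rightarrow> 'a \<Rightarrow> 'a" where
  "resolvent lam T x = (THE y. \<exists>v \<in> T y. x = y + lam *\<^sub>R v)"

definition common_zeros :: "'i measure \<Rightarrow> ('i \<Rightarrow> 'a::euclidean_space \<Rightarrow> 'a set) \<Rightarrow> 'a set" where
  "common_zeros M T = {x. AE i in M. 0 \<in> T i x}"

definition shift_seq :: "(nat \<Rightarrow> 'i) \<Rightarrow> (nat \<Rightarrow> 'i)" where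
  "shift_seq s = (\<lambda>n. s (Suc n))"

definition ergodic_stationary :: "'w measure \<Rightarrow> 'i measure \<Rightarrow> (nat \<Rightarrow> 'w \<Rightarrow> 'i) \<Rightarrow> bool" where
  "ergodic_stationary P M \<xi> \<longleftrightarrow>
     (let \<mu> = distr P (PiM UNIV (\<lambda>_. M)) (\<lambda>\<omega> n. \<xi> n \<omega>) in
        distr \<mu> (PiM UNIV (\<lambda>_. M)) shift_seq = \<mu> \<and>
        (\<forall>A \<in> sets \<mu>. shift_seq -` A \<inter> space \<mu> = A \<longrightarrow> emeasure \<mu> A = 0 \<or> emeasure \<mu> A = 1))"

primrec rpp_iter :: "real \<Rightarrow> real \<Rightarrow> ('i \<Rightarrow> 'a::euclidean_space \<Rightarrow> 'a set) \<Rightarrow>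
    (nat \<Rightarrow> 'w \<Rightarrow> 'i) \<Rightarrow> 'a \<Rightarrow> nat \<Rightarrow> 'w \<Rightarrow> 'a" where
  "rpp_iter lam \<alpha> T \<xi> x0 0 \<omega> = x0"
| "rpp_iter lam \<alpha> T \<xi> x0 (Suc n) \<omega> =
     rpp_iter lam \<alpha> T \<xi> x0 n \<omega> +
       \<alpha> *\<^sub>R (resolvent lam (T (\<xi> n \<omega>)) (rpp_iter lam \<alpha> T \<xi> x0 n \<omega>) - rpp_iter lam \<alpha> T \<xi> x0 n \<omega>)"

end

theory Submission
  imports Defs
begin

text \<open>
  By Minty's theorem every resolvent is an everywhere defined, firmly nonexpansive map whose fixed
  points are the zeros of the operator. Hence, almost surely, \<open>X\<^sub>n\<close> is Fejer monotone with respect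
  to a countable dense subset \<open>D\<close> of \<open>Z\<close>, and the residuals \<open>\<parallel>J\<^sub>\<xi>\<^sub>n X\<^sub>n - X\<^sub>n\<parallel>\<close>, which are proportional
  to the step sizes, tend to zero. It remains to see that \<open>X\<^sub>n\<close> comes arbitrarily close to \<open>Z\<close>.

  The points of the ball around some \<open>z\<^sub>0 \<in> D\<close> containing the orbit that have distance at least \<open>\<epsilon>\<close>
  from \<open>D\<close> form a compact set, covered by finitely many balls such that each centre is displaced
  noticeably by \<open>J\<^sub>i\<close> for all \<open>i\<close> in a set of positive measure. By ergodicity there is a length \<open>N\<close>
  such that infinitely many time windows of length \<open>N\<close> meet all of these sets of indices. The orbit
  barely moves during a late window, so if it were near a centre it would have a large residual in
  that window. Hence it leaves the compact set, that is, it comes \<open>\<epsilon>\<close>-close to \<open>D\<close>.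
\<close>

section \<open>Maximal monotone operators and Minty's theorem\<close>

lemma monotone_op_insert:
  assumes "monotone_op T" "\<And>u v. v \<in> T u \<Longrightarrow> inner (y - u) (w - v) \<ge> 0"
  shows "monotone_op (T(y := insert w (T y)))"
  unfolding monotone_op_def
proof (intro allI impI)
  fix x x' v v'
  assume v: "v \<in> (T(y := insert w (T y))) x" and v': "v' \<in> (T(y := insert w (T y))) x'"
  have sym: "inner (u - y) (v - w) \<ge> 0" if "v \<in> T u" for u v
    using assms(2)[OF that] by (simp add: inner_diff_left inner_diff_right)
  consider "v \<in> T x" "v' \<in> T x'" | "v \<in> T x" "x' = y" "v' = w"
    | "x = y" "v = w" "v' \<in> T x'" | "x = y" "x' = y"
    using v v' by (auto split: if_splits)
  then show "0 \<le> inner (x' - x) (v' - v)"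
    using assms sym unfolding monotone_op_def by cases auto
qed

text \<open>Adjoining \<open>w\<close> to \<open>T y\<close> keeps the operator monotone, so
  maximality forces \<open>w\<close> to be there already. This is the only way in which maximality
  enters.\<close>

lemma maximal_monotoneD:
  assumes "maximal_monotone T" "\<And>u v. v \<in> T u \<Longrightarrow> inner (y - u) (w - v) \<ge> 0"
  shows "w \<in> T y"
proof -
  have "T(y := insert w (T y)) = T"
    using assms monotone_op_insert[of T y w] unfolding maximal_monotone_def by auto
  then show ?thesis
    by (metis fun_upd_same insertI1)
qed

text \<open>The dual of the minimax problem \<open>min\<^sub>y max\<^sub>i \<langle>y - u\<^sub>i, y - w\<^sub>i\<rangle>\<close>: the value at a weight
  vector \<open>p\<close> is \<open>s - \<parallel>U + W\<parallel>\<^sup>2 / 4\<close> with \<open>(U, W, s) = \<Sum> p\<^sub>i (u\<^sub>i, w\<^sub>i, \<langle>u\<^sub>i, w\<^sub>i\<rangle>)\<close>. Antitonicity gives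
  \<open>s \<le> \<langle>U, W\<rangle>\<close>, so this value is nonpositive, and \<open>(U + W) / 2\<close> at a maximiser solves the primal
  problem by the first-order condition.\<close>
lemma antitone_finite_balls_Int:
  fixes G :: "('a::euclidean_space \<times> 'a) set"
  assumes fin: "finite G"
    and anti: "\<And>u w u' w'. (u, w) \<in> G \<Longrightarrow> (u', w') \<in> G \<Longrightarrow> inner (u - u') (w - w') \<le> 0"
  shows "\<exists>y. \<forall>(u, w) \<in> G. inner (y - u) (y - w) \<le> 0"
proof (cases "G = {}")
  case False
  define H where "H = convex hull ((\<lambda>(u, w). (u, w, inner u w)) ` G)"
  define \<phi> :: "'a \<times> 'a \<times> real \<Rightarrow> real"
    where "\<phi> = (\<lambda>q. snd (snd q) - inner (fst q + fst (snd q)) (fst q + fst (snd q)) / 4)"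
  have "compact H"
    unfolding H_def using fin by (intro compact_convex_hull finite_imp_compact finite_imageI)
  moreover have "H \<noteq> {}" unfolding H_def using False by simp
  moreover have "continuous_on H \<phi>" unfolding \<phi>_def by (intro continuous_intros) auto
  ultimately obtain q where q: "q \<in> H" "\<And>q'. q' \<in> H \<Longrightarrow> \<phi> q' \<le> \<phi> q"
    using continuous_attains_sup by metis
  obtain U W s where q_eq: "q = (U, W, s)" by (cases q)
  have "s \<le> inner U W"
  proof -
    obtain p where p: "\<forall>g\<in>G. 0 \<le> p g" "sum p G = 1"
      "(\<Sum>g\<in>G. p g *\<^sub>R (case g of (u, w) \<Rightarrow> (u, w, inner u w))) = (U, W, s)"
    proof -
      \<comment> \<open>The first two components determine the pair, so weights on the image pull
        back to weights on \<open>G\<close>.\<close>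
      have inj: "inj_on (\<lambda>(u, w). (u, w, inner u w)) G" by (auto simp: inj_on_def)
      have "q \<in> convex hull ((\<lambda>(u, w). (u, w, inner u w)) ` G)" using q by (simp add: H_def)
      then obtain p' where p': "\<forall>x\<in>(\<lambda>(u, w). (u, w, inner u w)) ` G. 0 \<le> p' x"
          "sum p' ((\<lambda>(u, w). (u, w, inner u w)) ` G) = 1"
          "(\<Sum>x\<in>(\<lambda>(u, w). (u, w, inner u w)) ` G. p' x *\<^sub>R x) = q"
        using fin by (subst (asm) convex_hull_finite) auto
      show ?thesis
        by (rule that[of "p' \<circ> (\<lambda>(u, w). (u, w, inner u w))"])
          (use p' in \<open>auto simp: sum.reindex[OF inj] q_eq o_def\<close>)
    qed
    have U: "U = (\<Sum>g\<in>G. p g *\<^sub>R fst g)" and W: "W = (\<Sum>g\<in>G. p g *\<^sub>R snd g)"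
      and s: "s = (\<Sum>g\<in>G. p g * inner (fst g) (snd g))"
      using arg_cong[OF p(3), of fst] arg_cong[OF p(3), of "fst \<circ> snd"] arg_cong[OF p(3), of "snd \<circ> snd"]
      by (simp_all add: fst_sum snd_sum case_prod_unfold)
    \<comment> \<open>This double sum equals \<open>2 * s - 2 * inner U W\<close>, and antitonicity
      makes each of its terms nonpositive.\<close>
    have "0 \<ge> (\<Sum>g\<in>G. \<Sum>h\<in>G. p g * p h * inner (fst g - fst h) (snd g - snd h))"
      using p(1) anti by (intro sum_nonpos mult_nonneg_nonpos) auto
    also have "(\<Sum>g\<in>G. \<Sum>h\<in>G. p g * p h * inner (fst g - fst h) (snd g - snd h))
      = (\<Sum>g\<in>G. \<Sum>h\<in>G. p g * inner (fst g) (snd g) * p h)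
      + (\<Sum>g\<in>G. \<Sum>h\<in>G. p g * (p h * inner (fst h) (snd h)))
      - (\<Sum>g\<in>G. \<Sum>h\<in>G. p g * p h * inner (fst g) (snd h))
      - (\<Sum>g\<in>G. \<Sum>h\<in>G. p g * p h * inner (fst h) (snd g))"
      by (simp add: sum.distrib[symmetric] sum_subtractf[symmetric] inner_diff_left inner_diff_right
          algebra_simps)
    also have "(\<Sum>g\<in>G. \<Sum>h\<in>G. p g * inner (fst g) (snd g) * p h) = s"
      by (simp add: sum_distrib_left[symmetric] p(2) s)
    also have "(\<Sum>g\<in>G. \<Sum>h\<in>G. p g * (p h * inner (fst h) (snd h))) = s"
      by (simp add: sum_distrib_left[symmetric] sum_distrib_right[symmetric] p(2) s)
    also have "(\<Sum>g\<in>G. \<Sum>h\<in>G. p g * p h * inner (fst g) (snd h)) = inner U W"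
      by (subst sum.swap) (simp add: U W inner_sum_left inner_sum_right sum_distrib_left algebra_simps)
    also have "(\<Sum>g\<in>G. \<Sum>h\<in>G. p g * p h * inner (fst h) (snd g)) = inner U W"
      by (simp add: U W inner_sum_left inner_sum_right sum_distrib_left algebra_simps)
    finally show ?thesis by simp
  qed
  define C where "C = U + W"
  have "\<phi> q \<le> 0"
  proof -
    \<comment> \<open>Polarization: since \<open>s\<close> is at most \<open>inner U W\<close>, the
      value \<open>\<phi> q\<close> is at most minus a quarter of the squared norm of
      \<open>U - W\<close>.\<close>
    have "inner C C - 4 * inner U W = inner (U - W) (U - W)"
      by (simp add: C_def inner_diff_left inner_diff_right inner_add_left inner_add_right inner_commute)
    then show ?thesis
      using \<open>s \<le> inner U W\<close> inner_ge_zero[of "U - W"]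
      unfolding \<phi>_def q_eq C_def[symmetric] fst_conv snd_conv by linarith
  qed
  have "inner ((1/2) *\<^sub>R C - u) ((1/2) *\<^sub>R C - w) \<le> 0" if g: "(u, w) \<in> G" for u w
  proof -
    \<comment> \<open>\<open>c\<close> is the velocity of \<open>U + W\<close> along the segment
      from the maximiser \<open>q\<close> to the vertex given by \<open>(u, w)\<close>. Comparing
      \<open>\<phi>\<close> on this segment with \<open>\<phi> q\<close> and dividing by
      \<open>t\<close> gives \<open>lin\<close>; as \<open>t\<close> tends to 0, the directional
      derivative is nonpositive.\<close>
    define c where "c = u + w - C"
    have lin: "inner u w - s - inner C c / 2 \<le> t * inner c c / 4" if t: "0 < t" "t < 1" for t
    proof -
      have "(u, w, inner u w) \<in> H"
        unfolding H_def using g by (intro hull_inc) (auto intro!: image_eqI[of _ _ "(u, w)"])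
      then have "(1 - t) *\<^sub>R q + t *\<^sub>R (u, w, inner u w) \<in> H"
        using q(1) t convex_convex_hull unfolding H_def by (intro convexD) auto
      from q(2)[OF this] have "s + t * (inner u w - s) - inner (C + t *\<^sub>R c) (C + t *\<^sub>R c) / 4 \<le> s - inner C C / 4"
        by (simp add: \<phi>_def q_eq C_def c_def algebra_simps)
      also have "inner (C + t *\<^sub>R c) (C + t *\<^sub>R c) = inner C C + 2 * t * inner C c + t * t * inner c c"
        by (simp add: inner_add_left inner_add_right inner_commute algebra_simps)
      finally have "t * (inner u w - s - inner C c / 2) \<le> t * (t * inner c c / 4)"
        by (simp add: field_simps)
      then show ?thesis using t by simp
    qed
    have "inner u w - s - inner C c / 2 \<le> 0"
    proof (rule tendsto_le[OF _ _ tendsto_const])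
      show "((\<lambda>t. t * inner c c / 4) \<longlongrightarrow> 0) (at_right (0::real))"
        by (auto intro!: tendsto_eq_intros)
      show "\<forall>\<^sub>F t in at_right (0::real). inner u w - s - inner C c / 2 \<le> t * inner c c / 4"
        using lin by (intro eventually_at_rightI[of 0 1]) (simp_all only: greaterThanLessThan_iff zero_less_one)
    qed simp
    \<comment> \<open>The primal value at \<open>C / 2\<close> is the directional derivative plus
      \<open>\<phi> q\<close>.\<close>
    moreover have "inner ((1/2) *\<^sub>R C - u) ((1/2) *\<^sub>R C - w)
        = inner u w - s - inner C c / 2 + (s - inner C C / 4)"
      by (simp add: c_def inner_diff_left inner_diff_right inner_add_left inner_add_right
          inner_commute field_simps)
    ultimately show ?thesis
      using \<open>\<phi> q \<le> 0\<close> by (simp add: \<phi>_def q_eq C_def)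
  qed
  then show ?thesis by blast
qed simp

text \<open>By Thales this set is the closed ball whose diameter is the segment from
  \<open>u\<close> to \<open>w\<close>. Compactness will allow passing from finite to arbitrary
  intersections.\<close>

lemma compact_diameter_ball:
  fixes u w :: "'a::euclidean_space"
  shows "compact {y. inner (y - u) (y - w) \<le> 0}"
proof -
  have "{y. inner (y - u) (y - w) \<le> 0} \<subseteq> cball u (norm (w - u))"
  proof
    fix y assume "y \<in> {y. inner (y - u) (y - w) \<le> 0}"
    moreover have "inner (y - u) (y - w) = inner (y - u) (y - u) - inner (y - u) (w - u)"
      by (simp add: inner_diff_right)
    ultimately have "norm (y - u) * norm (y - u) \<le> norm (y - u) * norm (w - u)"
      using norm_cauchy_schwarz[of "y - u" "w - u"]
      by (simp add: power2_norm_eq_inner[symmetric] power2_eq_square)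
    then show "y \<in> cball u (norm (w - u))"
      by (cases "y = u") (auto simp: dist_norm norm_minus_commute)
  qed
  moreover have "closed {y. inner (y - u) (y - w) \<le> 0}"
    by (intro closed_Collect_le continuous_intros)
  ultimately show ?thesis
    by (meson bounded_cball bounded_subset compact_eq_bounded_closed)
qed

text \<open>By maximality it suffices to find \<open>y\<close> with \<open>(x - y) / lam\<close>
  monotonically related to the whole graph. For a graph point \<open>(u, v)\<close> this says that
  \<open>y\<close> lies in the ball with diameter from \<open>u\<close> to
  \<open>x - lam *\<^sub>R v\<close>. These pairs of endpoints are antitone, so finitely many balls
  always meet, and by compactness all of them do.\<close>

theorem Minty:
  fixes T :: "'a::euclidean_space \<Rightarrow> 'a set"
  assumes T: "maximal_monotone T" and lam: "lam > 0"
  shows "\<exists>y. \<exists>v\<in>T y. x = y + lam *\<^sub>R v"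
proof -
  define G where "G = {(u, x - lam *\<^sub>R v) |u v. v \<in> T u}"
  define B where "B = (\<lambda>(u, w). {y::'a. inner (y - u) (y - w) \<le> 0})"
  have anti: "inner (u - u') (w - w') \<le> 0" if g: "(u, w) \<in> G" "(u', w') \<in> G" for u w u' w'
  proof -
    obtain v v' where v: "v \<in> T u" "v' \<in> T u'" "w = x - lam *\<^sub>R v" "w' = x - lam *\<^sub>R v'"
      using g by (auto simp: G_def)
    have "w - w' = - (lam *\<^sub>R (v - v'))" using v by (simp add: algebra_simps)
    moreover have "inner (u - u') (v - v') \<ge> 0"
      using T v unfolding maximal_monotone_def monotone_op_def by blast
    ultimately show ?thesis using lam by simp
  qed
  have "\<Inter>(B ` G) \<noteq> {}"
  proof (cases "G = {}")
    case False
    then obtain g where g: "g \<in> G" by blast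
    have cpt: "compact (B h)" for h by (cases h) (simp add: B_def compact_diameter_ball)
    \<comment> \<open>The finite intersection property is applied inside one fixed compact ball, so
      \<open>g\<close> joins every finite subfamily.\<close>
    have "B g \<inter> \<Inter>(B ` G) \<noteq> {}"
    proof (rule compact_imp_fip[OF cpt])
      show "closed S" if "S \<in> B ` G" for S using that cpt compact_imp_closed by blast
      fix F' assume "finite F'" "F' \<subseteq> B ` G"
      then obtain G' where G': "G' \<subseteq> G" "finite G'" "F' = B ` G'"
        by (meson finite_subset_image)
      have "\<exists>y. \<forall>(u, w) \<in> insert g G'. inner (y - u) (y - w) \<le> 0"
      proof (rule antitone_finite_balls_Int)
        show "finite (insert g G')" using G' by simp
        show "inner (u - u') (w - w') \<le> 0"
          if "(u, w) \<in> insert g G'" "(u', w') \<in> insert g G'" for u w u' w'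
          using that G'(1) g by (intro anti) blast+
      qed
      then show "B g \<inter> \<Inter>F' \<noteq> {}"
        using G' by (fastforce simp: B_def)
    qed
    then show ?thesis by blast
  qed simp
  then obtain y where y: "\<And>u v. v \<in> T u \<Longrightarrow> inner (y - u) (y - (x - lam *\<^sub>R v)) \<le> 0"
    by (fastforce simp: B_def G_def)
  have "(1 / lam) *\<^sub>R (x - y) \<in> T y"
  proof (rule maximal_monotoneD[OF T])
    fix u v assume "v \<in> T u"
    have "(1 / lam) *\<^sub>R (x - y) - v = - ((1 / lam) *\<^sub>R (y - (x - lam *\<^sub>R v)))"
      using lam by (simp add: algebra_simps)
    then show "0 \<le> inner (y - u) ((1 / lam) *\<^sub>R (x - y) - v)"
      using y[OF \<open>v \<in> T u\<close>] lam by (simp add: divide_nonpos_pos)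
  qed
  then show ?thesis using lam by (intro exI bexI) auto
qed

section \<open>Resolvents and their relaxed steps\<close>

lemma monotone_op_firm:
  assumes "monotone_op T" "lam > 0" "v \<in> T y" "v' \<in> T y'" "x = y + lam *\<^sub>R v" "x' = y' + lam *\<^sub>R v'"
  shows "inner (y - y') (y - y') \<le> inner (y - y') (x - x')"
proof -
  have "inner (y - y') (v - v') \<ge> 0" using assms unfolding monotone_op_def by blast
  moreover have "x - x' = (y - y') + lam *\<^sub>R (v - v')" using assms by (simp add: algebra_simps)
  ultimately show ?thesis using assms(2) by (simp add: inner_add_right)
qed

text \<open>For equal inputs the firm inequality bounds the squared distance of two solutions by 0.
  With Minty's theorem this makes the description in \<open>resolvent\<close> meaningful.\<close>

lemma resolvent_unique:
  assumes "maximal_monotone T" "lam > 0" "v \<in> T y" "x = y + lam *\<^sub>R v"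
  shows "resolvent lam T x = y"
  unfolding resolvent_def
proof (rule the_equality)
  show "\<exists>v\<in>T y. x = y + lam *\<^sub>R v" using assms by blast
  fix y' assume "\<exists>v\<in>T y'. x = y' + lam *\<^sub>R v"
  then obtain v' where "v' \<in> T y'" "x = y' + lam *\<^sub>R v'" by blast
  then have "inner (y' - y) (y' - y) \<le> inner (y' - y) (x - x)"
    using assms monotone_op_firm[of T lam v' y' v y x x] by (auto simp: maximal_monotone_def)
  then show "y' = y" using inner_eq_zero_iff[of "y' - y"] inner_ge_zero[of "y' - y"] by simp
qed

lemma resolventE:
  assumes "maximal_monotone T" "lam > 0"
  obtains v where "v \<in> T (resolvent lam T x)" "x = resolvent lam T x + lam *\<^sub>R v"
  using Minty[OF assms, of x] resolvent_unique[OF assms] by metis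

lemma resolvent_fixed_iff:
  assumes "maximal_monotone T" "lam > 0"
  shows "resolvent lam T z = z \<longleftrightarrow> 0 \<in> T z"
proof
  assume fix_z: "resolvent lam T z = z"
  obtain v where "v \<in> T (resolvent lam T z)" "z = resolvent lam T z + lam *\<^sub>R v"
    by (rule resolventE[OF assms])
  then show "0 \<in> T z" using fix_z assms(2) by auto
qed (auto intro: resolvent_unique[OF assms])

lemma resolvent_firmly_nonexpansive:
  assumes "maximal_monotone T" "lam > 0"
  shows "inner (resolvent lam T x - resolvent lam T y) (resolvent lam T x - resolvent lam T y)
    \<le> inner (resolvent lam T x - resolvent lam T y) (x - y)"
proof -
  obtain v where "v \<in> T (resolvent lam T x)" "x = resolvent lam T x + lam *\<^sub>R v"
    by (rule resolventE[OF assms])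
  moreover obtain w where "w \<in> T (resolvent lam T y)" "y = resolvent lam T y + lam *\<^sub>R w"
    by (rule resolventE[OF assms])
  ultimately show ?thesis
    using assms by (intro monotone_op_firm) (auto simp: maximal_monotone_def)
qed

lemma resolvent_nonexpansive:
  assumes "maximal_monotone T" "lam > 0"
  shows "dist (resolvent lam T x) (resolvent lam T y) \<le> dist x y"
proof -
  let ?d = "resolvent lam T x - resolvent lam T y"
  have "norm ?d * norm ?d \<le> norm ?d * norm (x - y)"
    using resolvent_firmly_nonexpansive[OF assms, of x y] norm_cauchy_schwarz[of ?d "x - y"]
    by (simp add: power2_norm_eq_inner[symmetric] power2_eq_square)
  then show ?thesis by (cases "?d = 0") (auto simp: dist_norm)
qed

text \<open>With \<open>d = x - z\<close> and residual \<open>e\<close>, firm nonexpansiveness at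
  the fixed point \<open>z\<close> reads \<open>inner e d \<le> - inner e e\<close>. Inserting this
  into the expanded square of \<open>d + \<alpha> *\<^sub>R e\<close> leaves the factor
  \<open>\<alpha> * (2 - \<alpha>)\<close>, positive for relaxation parameters in (0,2).\<close>

lemma relaxed_resolvent_descent:
  assumes "maximal_monotone T" "lam > 0" "resolvent lam T z = z" "\<alpha> \<ge> 0"
  shows "(dist (x + \<alpha> *\<^sub>R (resolvent lam T x - x)) z)\<^sup>2
    \<le> (dist x z)\<^sup>2 - \<alpha> * (2 - \<alpha>) * (dist (resolvent lam T x) x)\<^sup>2"
proof -
  define e where "e = resolvent lam T x - x"
  define d where "d = x - z"
  have r: "resolvent lam T x - resolvent lam T z = d + e" using assms(3) by (simp add: e_def d_def)
  have "inner e d \<le> - inner e e"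
    using resolvent_firmly_nonexpansive[OF assms(1,2), of x z, unfolded r]
    by (simp add: d_def[symmetric] inner_add_left inner_add_right inner_commute)
  then have "2 * \<alpha> * inner e d \<le> 2 * \<alpha> * - inner e e"
    using assms(4) by (intro mult_left_mono) auto
  moreover have "(dist (x + \<alpha> *\<^sub>R e) z)\<^sup>2 = inner d d + 2 * \<alpha> * inner e d + \<alpha> * \<alpha> * inner e e"
  proof -
    have "x + \<alpha> *\<^sub>R e - z = d + \<alpha> *\<^sub>R e" by (simp add: d_def)
    then show ?thesis
      unfolding dist_norm power2_norm_eq_inner
      by (simp only:) (simp add: inner_add_left inner_add_right inner_commute)
  qed
  moreover have "(dist x z)\<^sup>2 = inner d d" "(dist (resolvent lam T x) x)\<^sup>2 = inner e e"
    by (simp_all add: dist_norm power2_norm_eq_inner d_def e_def)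
  ultimately show ?thesis by (simp add: e_def[symmetric] algebra_simps)
qed

section \<open>Deterministic sequences: vanishing residuals, Fejer monotonicity, slow motion\<close>

text \<open>\<open>k * b n\<close> is dominated by the decrements of a convergent sequence. It will
  turn the descent inequality into vanishing residuals.\<close>

lemma decreasing_sum_tendsto_zero:
  fixes a b :: "nat \<Rightarrow> real"
  assumes "\<And>n. a (Suc n) \<le> a n - k * b n" "\<And>n. 0 \<le> a n" "\<And>n. 0 \<le> b n" "k > 0"
  shows "b \<longlonglongrightarrow> 0"
proof -
  have "a (Suc n) \<le> a n" for n
    using assms(1)[of n] mult_nonneg_nonneg[of k "b n"] assms(3)[of n] assms(4) by linarith
  then have "decseq a" by (rule decseq_SucI)
  then obtain L where L: "a \<longlonglongrightarrow> L" using decseq_convergent[of a 0] assms(2) by blast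
  have "(\<lambda>n. (a n - a (Suc n)) / k) \<longlonglongrightarrow> (L - L) / k"
    using L assms(4) by (intro tendsto_intros LIMSEQ_Suc) auto
  then have lim: "(\<lambda>n. (a n - a (Suc n)) / k) \<longlonglongrightarrow> 0" by simp
  have "b n \<le> (a n - a (Suc n)) / k" for n
    using assms(1)[of n] assms(4) by (simp add: field_simps)
  then show ?thesis
    using assms(3) by (intro tendsto_sandwich[OF _ _ tendsto_const lim]) auto
qed

text \<open>Once a term is within \<open>e / 2\<close> of a point of \<open>D\<close>, all later
  terms are too, so the sequence is Cauchy. The limit is at most as far from such a point as the
  term was.\<close>

lemma Fejer_monotone_convergent:
  fixes X :: "nat \<Rightarrow> 'a::complete_space"
  assumes fejer: "\<And>z n. z \<in> D \<Longrightarrow> dist (X (Suc n)) z \<le> dist (X n) z"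
    and close: "\<And>e. e > 0 \<Longrightarrow> \<exists>n. \<exists>z\<in>D. dist (X n) z < e"
  shows "\<exists>l\<in>closure D. X \<longlonglongrightarrow> l"
proof -
  have mono: "dist (X m) z \<le> dist (X n) z" if "z \<in> D" "n \<le> m" for z n m
    using lift_Suc_antimono_le[of "\<lambda>n. dist (X n) z", OF fejer[OF that(1)] that(2)] .
  have "Cauchy X"
  proof (rule metric_CauchyI)
    fix e :: real assume "0 < e"
    then obtain n z where nz: "z \<in> D" "dist (X n) z < e / 2" using close[of "e / 2"] by auto
    have "dist (X p) (X q) < e" if "p \<ge> n" "q \<ge> n" for p q
      using mono[OF nz(1) that(1)] mono[OF nz(1) that(2)] nz(2) dist_triangle2[of "X p" "X q" z]
      by linarith
    then show "\<exists>n. \<forall>p\<ge>n. \<forall>q\<ge>n. dist (X p) (X q) < e" by blast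
  qed
  then obtain l where l: "X \<longlonglongrightarrow> l" using Cauchy_convergent_iff convergent_def by blast
  have "l \<in> closure D"
  proof (subst closure_approachable, intro allI impI)
    fix e :: real assume "0 < e"
    then obtain n z where nz: "z \<in> D" "dist (X n) z < e" using close by blast
    have "dist l z \<le> dist (X n) z"
      using mono[OF nz(1)] by (intro LIMSEQ_le_const2[OF tendsto_dist[OF l tendsto_const]]) auto
    then show "\<exists>z\<in>D. dist z l < e" using nz by (metis dist_commute le_less_trans)
  qed
  then show ?thesis using l by blast
qed

text \<open>A slowly moving sequence is nearly constant along a window of fixed length, so a window in
  which every centre \<open>x\<close> is displaced by more than \<open>c x\<close> cannot start near one of the centres.\<close>
lemma slow_sequence_leaves_balls:
  fixes X :: "nat \<Rightarrow> 'a::metric_space"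
  assumes nonexp: "\<And>n x y. dist (J n x) (J n y) \<le> dist x y"
    and step: "(\<lambda>n. dist (X (Suc n)) (X n)) \<longlonglongrightarrow> 0"
    and res: "(\<lambda>n. dist (J n (X n)) (X n)) \<longlonglongrightarrow> 0"
    and C: "finite C" "\<And>x. x \<in> C \<Longrightarrow> c x > 0"
    and windows: "\<exists>\<^sub>\<infinity>n. \<forall>x\<in>C. \<exists>m<N. dist (J (n + m) x) x > c x"
  shows "\<exists>n. X n \<notin> (\<Union>x\<in>C. ball x (c x / 4))"
proof (cases "C = {}")
  case False
  define \<delta> where "\<delta> = Min (c ` C)"
  have \<delta>: "\<delta> > 0" "\<And>x. x \<in> C \<Longrightarrow> \<delta> \<le> c x" using C False by (auto simp: \<delta>_def)
  \<comment> \<open>With this choice \<open>(N + 1) * \<eta> = \<delta> / 4\<close>. The error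
    \<open>2 * N * \<eta> + \<eta>\<close> from drift and residual is then below
    \<open>c x / 2\<close>; being within \<open>c x / 4\<close> of the centre, counted twice, costs
    the other half.\<close>
  define \<eta> where "\<eta> = \<delta> / (4 * (real N + 1))"
  have \<eta>: "\<eta> > 0" using \<delta> by (simp add: \<eta>_def)
  have "\<forall>\<^sub>F n in sequentially. dist (X (Suc n)) (X n) < \<eta> \<and> dist (J n (X n)) (X n) < \<eta>"
    using order_tendstoD(2)[OF step \<eta>] order_tendstoD(2)[OF res \<eta>] by eventually_elim auto
  then obtain n0 where n0: "\<And>n. n \<ge> n0 \<Longrightarrow> dist (X (Suc n)) (X n) < \<eta>"
      "\<And>n. n \<ge> n0 \<Longrightarrow> dist (J n (X n)) (X n) < \<eta>"
    by (auto simp: eventually_sequentially)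
  obtain n where n: "n \<ge> n0" "\<And>x. x \<in> C \<Longrightarrow> \<exists>m<N. dist (J (n + m) x) x > c x"
    using windows unfolding INFM_nat_le by blast
  have drift: "dist (X (n + m)) (X n) \<le> m * \<eta>" for m
  proof (induction m)
    case (Suc m)
    then show ?case
      using n0(1)[of "n + m"] n(1) dist_triangle[of "X (n + Suc m)" "X n" "X (n + m)"]
      by (simp add: algebra_simps)
  qed simp
  have "X n \<notin> ball x (c x / 4)" if x: "x \<in> C" for x
  proof
    assume near: "X n \<in> ball x (c x / 4)"
    obtain m where m: "m < N" "dist (J (n + m) x) x > c x" using n(2)[OF x] by blast
    let ?Y = "X (n + m)" and ?J = "J (n + m)"
    have "m * \<eta> \<le> N * \<eta>" using m(1) \<eta> by (intro mult_right_mono) auto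
    then have 1: "dist ?Y x < N * \<eta> + c x / 4"
      using drift[of m] near dist_triangle[of ?Y x "X n"] by (simp add: dist_commute)
    have "dist (?J x) x \<le> dist (?J x) (?J ?Y) + dist (?J ?Y) ?Y + dist ?Y x"
      using dist_triangle[of "?J x" x ?Y] dist_triangle[of "?J x" ?Y "?J ?Y"] by linarith
    also have "\<dots> \<le> 2 * dist ?Y x + \<eta>"
      using nonexp[of "n + m" x ?Y] n0(2)[of "n + m"] n(1) by (simp add: dist_commute)
    also have "\<dots> < c x / 2 + 2 * ((real N + 1) * \<eta>)"
      using 1 \<eta> by (simp add: algebra_simps)
    also have "(real N + 1) * \<eta> = \<delta> / 4"
      by (simp add: \<eta>_def field_simps)
    also have "c x / 2 + 2 * (\<delta> / 4) \<le> c x" using \<delta>(2)[OF x] by simp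
    finally show False using m(2) by simp
  qed
  then show ?thesis by blast
qed simp

section \<open>Recurrence for ergodic stationary sequences\<close>

text \<open>Let \<open>U n\<close> be the event of a visit at some time from \<open>n\<close> on.
  Its preimage is \<open>U (Suc n)\<close>, so by invariance all \<open>U n\<close> have the measure
  of \<open>U 0\<close>, which is at least that of \<open>A\<close>. Their decreasing intersection
  is therefore an invariant set of positive measure, hence of measure 1.\<close>

lemma ergodic_visits_infinitely_often:
  assumes "prob_space \<mu>" and f[measurable]: "f \<in> measurable \<mu> \<mu>" and inv: "distr \<mu> \<mu> f = \<mu>"
    and erg: "\<And>A. A \<in> sets \<mu> \<Longrightarrow> f -` A \<inter> space \<mu> = A \<Longrightarrow> emeasure \<mu> A = 0 \<or> emeasure \<mu> A = 1"
    and A[measurable]: "A \<in> sets \<mu>" and pos: "emeasure \<mu> A \<noteq> 0"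
  shows "AE s in \<mu>. \<exists>\<^sub>\<infinity>n. (f ^^ n) s \<in> A"
proof -
  interpret prob_space \<mu> by fact
  define U where "U n = {s \<in> space \<mu>. \<exists>m\<ge>n. (f ^^ m) s \<in> A}" for n
  have [measurable]: "(f ^^ m) \<in> measurable \<mu> \<mu>" for m
    by (induction m) (auto intro: measurable_comp)
  have U[measurable]: "U n \<in> sets \<mu>" for n unfolding U_def by measurable
  have pre: "f -` U n \<inter> space \<mu> = U (Suc n)" for n
  proof -
    have "(\<exists>m\<ge>n. (f ^^ m) (f s) \<in> A) \<longleftrightarrow> (\<exists>m\<ge>Suc n. (f ^^ m) s \<in> A)" for s
      by (metis Suc_le_D Suc_le_mono comp_apply funpow_Suc_right)
    then show ?thesis using measurable_space[OF f] by (auto simp: U_def)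
  qed
  have U_const: "emeasure \<mu> (U n) = emeasure \<mu> (U 0)" for n
  proof (induction n)
    case (Suc n)
    have "emeasure \<mu> (U (Suc n)) = emeasure (distr \<mu> \<mu> f) (U n)"
      by (simp add: emeasure_distr pre)
    then show ?case using Suc inv by simp
  qed simp
  have dec: "decseq U" unfolding decseq_def U_def by (blast intro: order_trans)
  have "(INF n. emeasure \<mu> (U n)) = emeasure \<mu> (\<Inter>n. U n)"
    using dec by (intro INF_emeasure_decseq) auto
  moreover have "(INF n. emeasure \<mu> (U n)) = (INF n::nat. emeasure \<mu> (U 0))"
    using U_const by (intro INF_cong refl)
  ultimately have "emeasure \<mu> (\<Inter>n. U n) = emeasure \<mu> (U 0)" by simp
  moreover have "emeasure \<mu> A \<le> emeasure \<mu> (U 0)"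
    using sets.sets_into_space[OF A] by (intro emeasure_mono) (auto simp: U_def intro: exI[of _ 0])
  ultimately have "emeasure \<mu> (\<Inter>n. U n) \<noteq> 0" using pos by auto
  moreover have "f -` (\<Inter>n. U n) \<inter> space \<mu> = (\<Inter>n. U n)"
  proof -
    have "f -` (\<Inter>n. U n) \<inter> space \<mu> = (\<Inter>n. U (Suc n))" using pre by blast
    also have "\<dots> = (\<Inter>n. U n)" using dec by (fastforce simp: decseq_Suc_iff)
    finally show ?thesis .
  qed
  ultimately have "emeasure \<mu> (\<Inter>n. U n) = 1" using erg[of "\<Inter>n. U n"] by auto
  then have "AE s in \<mu>. s \<in> (\<Inter>n. U n)" by (intro AE_prob_1) (simp add: measure_def)
  then show ?thesis by eventually_elim (auto simp: U_def INFM_nat_le)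
qed

lemma funpow_shift_seq: "(shift_seq ^^ n) s m = s (n + m)"
  by (induction n arbitrary: m) (auto simp: shift_seq_def)

text \<open>Recurrence is used twice: first for each \<open>B x\<close> separately, so that almost
  every path meets all of them and some window length \<open>N\<close> succeeds with positive
  probability; then for the event \<open>W N\<close> itself.\<close>

lemma ergodic_stationary_windows:
  assumes P: "prob_space P" and \<xi>: "\<And>n. \<xi> n \<in> measurable P M" and law: "distr P M (\<xi> 0) = M"
    and es: "ergodic_stationary P M \<xi>"
    and C: "finite C" "\<And>x. x \<in> C \<Longrightarrow> B x \<in> sets M" "\<And>x. x \<in> C \<Longrightarrow> emeasure M (B x) \<noteq> 0"
  shows "\<exists>N. AE \<omega> in P. \<exists>\<^sub>\<infinity>n. \<forall>x\<in>C. \<exists>m<N. \<xi> (n + m) \<omega> \<in> B x"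
proof -
  let ?Pi = "PiM UNIV (\<lambda>_::nat. M)"
  define \<mu> where "\<mu> = distr P ?Pi (\<lambda>\<omega> n. \<xi> n \<omega>)"
  have seq[measurable]: "(\<lambda>\<omega> n. \<xi> n \<omega>) \<in> measurable P ?Pi"
    using \<xi> by (intro measurable_PiM_single') (auto dest: measurable_space)
  interpret \<mu>: prob_space \<mu> unfolding \<mu>_def using P seq by (rule prob_space.prob_space_distr)
  have sets_\<mu>[measurable_cong]: "sets \<mu> = sets ?Pi" by (simp add: \<mu>_def)
  have shift[measurable]: "shift_seq \<in> measurable \<mu> \<mu>"
  proof -
    have "shift_seq \<in> measurable ?Pi ?Pi"
      unfolding shift_seq_def by (intro measurable_PiM_single') (auto simp: space_PiM)
    then show ?thesis by (simp cong: measurable_cong_sets add: sets_\<mu>)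
  qed
  have inv: "distr \<mu> \<mu> shift_seq = \<mu>"
  proof -
    have "distr \<mu> \<mu> shift_seq = distr \<mu> ?Pi shift_seq" by (rule distr_cong) (auto simp: sets_\<mu>)
    then show ?thesis using es unfolding ergodic_stationary_def by (simp add: Let_def \<mu>_def)
  qed
  have erg: "emeasure \<mu> A = 0 \<or> emeasure \<mu> A = 1"
    if "A \<in> sets \<mu>" "shift_seq -` A \<inter> space \<mu> = A" for A
    using es that unfolding ergodic_stationary_def by (simp add: Let_def \<mu>_def)
  note recur = ergodic_visits_infinitely_often[OF \<mu>.prob_space_axioms shift inv erg]
  have hit: "AE s in \<mu>. \<exists>m. s m \<in> B x" if x: "x \<in> C" for x
  proof -
    note C(2)[OF x, measurable]
    let ?A = "{s \<in> space \<mu>. s 0 \<in> B x}"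
    have A: "?A \<in> sets \<mu>" by measurable
    \<comment> \<open>Coordinate 0 has law \<open>M\<close> under \<open>\<mu>\<close>, so
      \<open>?A\<close> inherits the mass of \<open>B x\<close>.\<close>
    have "emeasure \<mu> ?A = emeasure (distr \<mu> M (\<lambda>s. s 0)) (B x)"
      by (subst emeasure_distr) (auto intro!: arg_cong[where f="emeasure \<mu>"])
    also have "distr \<mu> M (\<lambda>s. s 0) = M"
      using law by (simp add: \<mu>_def distr_distr o_def)
    finally have "emeasure \<mu> ?A \<noteq> 0" using C(3)[OF x] by simp
    from recur[OF _ _ A this] have "AE s in \<mu>. \<exists>\<^sub>\<infinity>n. (shift_seq ^^ n) s \<in> ?A" by auto
    then show ?thesis
      by eventually_elim (auto simp: funpow_shift_seq dest!: INFM_EX)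
  qed
  define W where "W N = {s \<in> space \<mu>. \<forall>x\<in>C. \<exists>m<N. s m \<in> B x}" for N
  have W[measurable]: "W N \<in> sets \<mu>" for N
  proof -
    have "{s \<in> space \<mu>. \<exists>m<N. s m \<in> B x} \<in> sets \<mu>" if "x \<in> C" for x
      using C(2)[OF that] by measurable
    then show ?thesis unfolding W_def using C(1) by (intro sets.sets_Collect_finite_All)
  qed
  have "\<exists>N. emeasure \<mu> (W N) \<noteq> 0"
  proof (rule ccontr)
    assume "\<not> (\<exists>N. emeasure \<mu> (W N) \<noteq> 0)"
    then have "AE s in \<mu>. \<forall>N. s \<notin> W N"
      by (subst AE_all_countable) (auto intro!: AE_not_in null_setsI)
    moreover have "AE s in \<mu>. \<forall>x\<in>C. \<exists>m. s m \<in> B x"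
      using hit C(1) by (intro AE_finite_allI) auto
    ultimately have "AE s in \<mu>. False"
      using AE_space
    proof eventually_elim
      case (elim s)
      \<comment> \<open>Finitely many hitting times have a maximum; \<open>Suc\<close> accounts for
        the strict bound in \<open>W\<close>.\<close>
      obtain h where h: "\<And>x. x \<in> C \<Longrightarrow> s (h x) \<in> B x" using elim by metis
      have "\<exists>m<Suc (Max (h ` C)). s m \<in> B x" if "x \<in> C" for x
        using h[OF that] C(1) that by (intro exI[of _ "h x"]) (auto simp: less_Suc_eq_le)
      then have "s \<in> W (Suc (Max (h ` C)))" using elim by (simp add: W_def)
      then show ?case using elim by blast
    qed
    then show False by (simp add: \<mu>.AE_False)
  qed
  then obtain N where "emeasure \<mu> (W N) \<noteq> 0" by blast
  from recur[OF _ _ W this] have "AE s in \<mu>. \<exists>\<^sub>\<infinity>n. (shift_seq ^^ n) s \<in> W N" by auto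
  then have "AE s in \<mu>. \<exists>\<^sub>\<infinity>n. \<forall>x\<in>C. \<exists>m<N. s (n + m) \<in> B x"
    by eventually_elim (auto simp: W_def funpow_shift_seq elim!: INFM_mono)
  then show ?thesis unfolding \<mu>_def using AE_distrD[OF seq] by blast
qed

section \<open>Almost sure convergence of the random iteration\<close>

theorem theoremD:
  fixes M :: "'i measure" and P :: "'w measure"
    and T :: "'i \<Rightarrow> 'a::euclidean_space \<Rightarrow> 'a set"
    and \<xi> :: "nat \<Rightarrow> 'w \<Rightarrow> 'i"
    and lam \<alpha> :: real and x0 :: 'a
  assumes "prob_space M"
    and "\<forall>i \<in> space M. maximal_monotone (T i)"
    and "lam > 0" and "0 < \<alpha>" and "\<alpha> < 2"
    and "(\<lambda>(i, x). resolvent lam (T i) x) \<in> borel_measurable (M \<Otimes>\<^sub>M borel)"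
    and "common_zeros M T \<noteq> {}"
    and "prob_space P"
    and "\<forall>n. \<xi> n \<in> measurable P M"
    and "\<forall>n. distr P M (\<xi> n) = M"
    and "ergodic_stationary P M \<xi>"
  shows "\<exists>X. X \<in> borel_measurable P \<and>
           (AE \<omega> in P. (\<lambda>n. rpp_iter lam \<alpha> T \<xi> x0 n \<omega>) \<longlonglongrightarrow> X \<omega>) \<and>
           (AE \<omega> in P. X \<omega> \<in> common_zeros M T)"
proof -
  define J where "J i = resolvent lam (T i)" for i
  define X where "X = rpp_iter lam \<alpha> T \<xi> x0"
  define Z where "Z = common_zeros M T"
  interpret M: prob_space M by fact
  have mm: "maximal_monotone (T i)" if "i \<in> space M" for i using assms that by blast
  note lam = assms(3)
  have \<xi>[measurable]: "\<xi> n \<in> measurable P M" for n using assms by blast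
  have Jmeas: "(\<lambda>(i, x). J i x) \<in> borel_measurable (M \<Otimes>\<^sub>M borel)"
    using assms(6) by (simp add: J_def)
  have J_comp[measurable]: "(\<lambda>\<omega>. J (g \<omega>) (h \<omega>)) \<in> borel_measurable P"
    if "g \<in> measurable P M" "h \<in> borel_measurable P" for g h
    using measurable_compose[OF measurable_Pair[OF that] Jmeas] by simp
  have J_comp_M: "(\<lambda>i. J i x) \<in> borel_measurable M" for x
    using measurable_compose[OF measurable_Pair[OF measurable_ident measurable_const] Jmeas, of x]
    by simp
  have nonexp: "dist (J i x) (J i y) \<le> dist x y" if "i \<in> space M" for i x y
    unfolding J_def using mm[OF that] lam by (rule resolvent_nonexpansive)
  have Z_iff: "x \<in> Z \<longleftrightarrow> (AE i in M. J i x = x)" for x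
    unfolding Z_def common_zeros_def J_def mem_Collect_eq
    by (rule AE_cong) (simp add: resolvent_fixed_iff mm lam)
  have X_Suc: "X (Suc n) \<omega> = X n \<omega> + \<alpha> *\<^sub>R (J (\<xi> n \<omega>) (X n \<omega>) - X n \<omega>)" for n \<omega>
    by (simp add: X_def J_def)
  have X_meas[measurable]: "X n \<in> borel_measurable P" for n
  proof (induction n)
    case 0
    then show ?case by (simp add: X_def)
  next
    case (Suc n)
    note Suc[measurable]
    have "(\<lambda>\<omega>. X n \<omega> + \<alpha> *\<^sub>R (J (\<xi> n \<omega>) (X n \<omega>) - X n \<omega>)) \<in> borel_measurable P"
      by measurable
    then show ?case using X_Suc by (subst measurable_cong) auto
  qed
  \<comment> \<open>The null set off which \<open>z\<close> is fixed depends on \<open>z\<close>;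
    only countably many such sets can be discarded together, hence a countable dense
    \<open>D\<close>.\<close>
  obtain D where D: "countable D" "D \<subseteq> Z" "Z \<subseteq> closure D" by (rule separable)
  have "Z \<noteq> {}" using assms(7) by (simp add: Z_def)
  then obtain z0 where z0: "z0 \<in> D" using D by (metis closure_empty ex_in_conv subset_empty)
  have fixD: "AE \<omega> in P. \<forall>z\<in>D. \<forall>n. J (\<xi> n \<omega>) z = z"
  proof (subst AE_ball_countable[OF D(1)], intro ballI, subst AE_all_countable, intro allI)
    fix z n assume "z \<in> D"
    then have "AE i in distr P M (\<xi> n). J i z = z"
      using D(2) Z_iff[of z] unfolding spec[OF assms(10), of n] by blast
    then show "AE \<omega> in P. J (\<xi> n \<omega>) z = z" by (rule AE_distrD[OF \<xi>])
  qed
  \<comment> \<open>Off one null set all \<open>z n\<close> are fixed by \<open>J i\<close>, and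
    nonexpansiveness passes this on to their limit.\<close>
  have closure_D: "closure D \<subseteq> Z"
  proof
    fix x assume "x \<in> closure D"
    then obtain z where z: "\<And>n. z n \<in> D" "z \<longlonglongrightarrow> x" by (auto simp: closure_sequential)
    have "AE i in M. \<forall>n. J i (z n) = z n"
      using z(1) D(2) Z_iff by (subst AE_all_countable) auto
    then have "AE i in M. J i x = x"
      using AE_space
    proof eventually_elim
      case (elim i)
      have "(\<lambda>n. dist (J i x) (z n)) \<longlonglongrightarrow> 0"
      proof (rule tendsto_sandwich[OF _ _ tendsto_const])
        show "(\<lambda>n. dist x (z n)) \<longlonglongrightarrow> 0" using tendsto_dist[OF tendsto_const z(2), of x] by simp
        show "\<forall>\<^sub>F n in sequentially. dist (J i x) (z n) \<le> dist x (z n)"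
          using elim nonexp[of i x] by (metis (no_types, lifting) always_eventually)
      qed simp
      then have "z \<longlonglongrightarrow> J i x" by (subst tendsto_dist_iff) (simp add: dist_commute)
      then show ?case using z(2) LIMSEQ_unique by blast
    qed
    then show "x \<in> Z" using Z_iff by blast
  qed
  have \<xi>_space: "AE \<omega> in P. \<forall>n. \<xi> n \<omega> \<in> space M"
    using AE_space by eventually_elim (auto intro: measurable_space[OF \<xi>])
  have descent: "AE \<omega> in P. \<forall>z\<in>D. \<forall>n. (dist (X (Suc n) \<omega>) z)\<^sup>2
      \<le> (dist (X n \<omega>) z)\<^sup>2 - \<alpha> * (2 - \<alpha>) * (dist (J (\<xi> n \<omega>) (X n \<omega>)) (X n \<omega>))\<^sup>2"
    using fixD \<xi>_space
  proof eventually_elim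
    case (elim \<omega>)
    then show ?case unfolding X_Suc
      using relaxed_resolvent_descent[OF mm lam] assms(4) by (auto simp: J_def)
  qed
  have fejer: "AE \<omega> in P. \<forall>z\<in>D. \<forall>n. dist (X (Suc n) \<omega>) z \<le> dist (X n \<omega>) z"
    using descent
  proof eventually_elim
    case (elim \<omega>)
    have "(dist (X (Suc n) \<omega>) z)\<^sup>2 \<le> (dist (X n \<omega>) z)\<^sup>2" if "z \<in> D" for z n
    proof -
      have "0 \<le> \<alpha> * (2 - \<alpha>) * (dist (J (\<xi> n \<omega>) (X n \<omega>)) (X n \<omega>))\<^sup>2"
        using assms(4,5) by simp
      moreover have "(dist (X (Suc n) \<omega>) z)\<^sup>2
          \<le> (dist (X n \<omega>) z)\<^sup>2 - \<alpha> * (2 - \<alpha>) * (dist (J (\<xi> n \<omega>) (X n \<omega>)) (X n \<omega>))\<^sup>2"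
        using elim that by blast
      ultimately show ?thesis by linarith
    qed
    then show ?case by (auto intro!: power2_le_imp_le)
  qed
  have res: "AE \<omega> in P. (\<lambda>n. dist (J (\<xi> n \<omega>) (X n \<omega>)) (X n \<omega>)) \<longlonglongrightarrow> 0"
    using descent
  proof eventually_elim
    case (elim \<omega>)
    have "(\<lambda>n. (dist (J (\<xi> n \<omega>) (X n \<omega>)) (X n \<omega>))\<^sup>2) \<longlonglongrightarrow> 0"
      by (rule decreasing_sum_tendsto_zero[where a = "\<lambda>n. (dist (X n \<omega>) z0)\<^sup>2" and k = "\<alpha> * (2 - \<alpha>)"])
        (use elim z0 assms(4,5) in auto)
    from tendsto_real_sqrt[OF this] show ?case by simp
  qed
  have close: "AE \<omega> in P. \<exists>n. \<exists>z\<in>D. dist (X n \<omega>) z < e" if "e > 0" for e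
  proof -
    \<comment> \<open>Fejer monotonicity at \<open>z0\<close> keeps the orbit in this ball, so
      leaving \<open>K\<close> means coming within \<open>e\<close> of \<open>D\<close>.\<close>
    define K where "K = cball z0 (dist x0 z0) - (\<Union>z\<in>D. ball z e)"
    have "compact K" unfolding K_def by (intro compact_diff compact_cball open_UN) auto
    \<comment> \<open>Otherwise \<open>J i x = x\<close> for almost every \<open>i\<close>, which
      puts \<open>x\<close> in \<open>Z\<close> and thus in the closure of \<open>D\<close>.\<close>
    have "\<exists>c>0. emeasure M {i \<in> space M. dist (J i x) x > c} \<noteq> 0" if "x \<in> K" for x
    proof (rule ccontr)
      assume *: "\<not> ?thesis"
      have [measurable]: "(\<lambda>i. J i x) \<in> borel_measurable M" by (rule J_comp_M)
      have "AE i in M. \<forall>k. dist (J i x) x \<le> inverse (real (Suc k))"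
      proof (subst AE_all_countable, intro allI)
        fix k
        have "emeasure M {i \<in> space M. dist (J i x) x > inverse (real (Suc k))} = 0"
          using * by (auto simp del: of_nat_Suc)
        then have "AE i in M. i \<notin> {i \<in> space M. dist (J i x) x > inverse (real (Suc k))}"
          by (intro AE_not_in null_setsI) auto
        then show "AE i in M. dist (J i x) x \<le> inverse (real (Suc k))"
          using AE_space by eventually_elim auto
      qed
      then have "AE i in M. J i x = x"
      proof eventually_elim
        case (elim i)
        have "dist (J i x) x \<le> 0"
          using elim by (intro LIMSEQ_le_const[OF LIMSEQ_inverse_real_of_nat]) auto
        then show ?case by simp
      qed
      then have "x \<in> closure D" using Z_iff D by blast
      then obtain z where "z \<in> D" "dist z x < e"
        using \<open>e > 0\<close> by (auto simp: closure_approachable)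
      then show False using that by (auto simp: K_def)
    qed
    then obtain c where c: "\<And>x. x \<in> K \<Longrightarrow> c x > 0"
        "\<And>x. x \<in> K \<Longrightarrow> emeasure M {i \<in> space M. dist (J i x) x > c x} \<noteq> 0" by metis
    have "K \<subseteq> (\<Union>x\<in>K. ball x (c x / 4))" using c(1) by force
    then obtain C where C: "C \<subseteq> K" "finite C" "K \<subseteq> (\<Union>x\<in>C. ball x (c x / 4))"
      using compactE_image[OF \<open>compact K\<close>, of K "\<lambda>x. ball x (c x / 4)"] by auto
    have meas: "{i \<in> space M. dist (J i x) x > c x} \<in> sets M" for x
      using J_comp_M[of x] by measurable
    have pos: "emeasure M {i \<in> space M. dist (J i x) x > c x} \<noteq> 0" if "x \<in> C" for x
      using c(2) C(1) that by blast
    obtain N where N: "AE \<omega> in P. \<exists>\<^sub>\<infinity>n. \<forall>x\<in>C. \<exists>m<N.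
        \<xi> (n + m) \<omega> \<in> {i \<in> space M. dist (J i x) x > c x}"
      using ergodic_stationary_windows[where B = "\<lambda>x. {i \<in> space M. dist (J i x) x > c x}",
          OF assms(8) \<xi> spec[OF assms(10)] assms(11) C(2) meas pos]
      by blast
    show ?thesis
      using N fejer res \<xi>_space
    proof eventually_elim
      case (elim \<omega>)
      have "\<exists>n. X n \<omega> \<notin> (\<Union>x\<in>C. ball x (c x / 4))"
      proof (rule slow_sequence_leaves_balls)
        show "dist (J (\<xi> n \<omega>) x) (J (\<xi> n \<omega>) y) \<le> dist x y" for n x y
          using elim nonexp by blast
        show "(\<lambda>n. dist (J (\<xi> n \<omega>) (X n \<omega>)) (X n \<omega>)) \<longlonglongrightarrow> 0" by fact
        have "dist (X (Suc n) \<omega>) (X n \<omega>) = \<alpha> * dist (J (\<xi> n \<omega>) (X n \<omega>)) (X n \<omega>)" for n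
          using assms(4) by (simp add: X_Suc dist_norm)
        then show "(\<lambda>n. dist (X (Suc n) \<omega>) (X n \<omega>)) \<longlonglongrightarrow> 0"
          using tendsto_mult_right_zero[OF elim(3), of \<alpha>] by simp
        show "\<exists>\<^sub>\<infinity>n. \<forall>x\<in>C. \<exists>m<N. dist (J (\<xi> (n + m) \<omega>) x) x > c x"
          using elim(1) by (rule INFM_mono) auto
      qed (use C c in auto)
      then obtain n where "X n \<omega> \<notin> K" using C(3) by blast
      moreover have "dist (X n \<omega>) z0 \<le> dist x0 z0"
      proof (induction n)
        case (Suc n)
        then show ?case using elim(2) z0 by (meson order_trans)
      qed (simp add: X_def)
      ultimately show ?case by (auto simp: K_def dist_commute)
    qed
  qed
  \<comment> \<open>The null set in \<open>close\<close> depends on \<open>e\<close>, so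
    \<open>e\<close> is restricted to a sequence tending to 0.\<close>
  have "AE \<omega> in P. \<forall>k. \<exists>n. \<exists>z\<in>D. dist (X n \<omega>) z < inverse (real (Suc k))"
    by (subst AE_all_countable) (auto intro: close simp del: of_nat_Suc)
  then have conv: "AE \<omega> in P. \<exists>l\<in>closure D. (\<lambda>n. X n \<omega>) \<longlonglongrightarrow> l"
    using fejer
  proof eventually_elim
    case (elim \<omega>)
    show ?case
    proof (rule Fejer_monotone_convergent)
      show "dist (X (Suc n) \<omega>) z \<le> dist (X n \<omega>) z" if "z \<in> D" for z n using elim that by blast
      fix e :: real assume "e > 0"
      then obtain k where "inverse (real (Suc k)) < e" using reals_Archimedean by blast
      then show "\<exists>n. \<exists>z\<in>D. dist (X n \<omega>) z < e" using elim(1) by (meson less_trans)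
    qed
  qed
  show ?thesis
  proof (intro exI conjI)
    \<comment> \<open>\<open>lim\<close> is total, which gives a measurable limit without redefining
      it on the exceptional null set.\<close>
    show "(\<lambda>\<omega>. lim (\<lambda>n. X n \<omega>)) \<in> borel_measurable P" by measurable
    show "AE \<omega> in P. (\<lambda>n. rpp_iter lam \<alpha> T \<xi> x0 n \<omega>) \<longlonglongrightarrow> lim (\<lambda>n. X n \<omega>)"
      using conv by eventually_elim (auto simp: X_def[symmetric] limI)
    show "AE \<omega> in P. lim (\<lambda>n. X n \<omega>) \<in> common_zeros M T"
      using conv by eventually_elim (use closure_D in \<open>auto simp: Z_def[symmetric] limI\<close>)
  qed
qed

end
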